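(* Let $T\in(0,\infty]$, let $a,b:[0,T)\to\mathbb{R}$ be continuous, and let $\omega_0>0$ and $\omega_1\in\mathbb{R}$. Let $v_1$ and $v_2$ be the solutions of $v''+a\,v'+b\,v=0$ on $(0,T)$ with initial data $$v_1(0)=0,\quad v_1'(0)=1,\qquad v_2(0)=\frac{1}{\omega_0},\quad v_2'(0)=-\frac{1}{\omega_0}\left(\frac{a(0)}{2}+\frac{\omega_1}{2\,\omega_0}\right).$$ Let $\omega$ be either of the following two frequency functions: (i) (real-valued variant, for $v_1^2(0)+v_2^2(0)>0$) $$\omega(t):=\frac{v_1'(t)\,v_2(t)-v_1(t)\,v_2'(t)}{v_1^2(t)+v_2^2(t)};$$ (ii) (imaginary-valued variant, for $v_2^2(0)-v_1^2(0)>0$) $$\omega(t):=\mathrm{i}\,\epsilon(t):=\mathrm{i}\,\frac{v_1'(t)\,v_2(t)-v_1(t)\,v_2'(t)}{v_2^2(t)-v_1^2(t)}.$$ Let $\alpha:=\frac{a}{2}+\frac{\omega'}{2\,\omega}$, and let $f_0$ be continuous with $\operatorname{supp}(f_0)\subset(0,\infty)$. Then, in either case, the solution of $$v''+a\,v'+b\,v=f_0\ \text{ on }(0,T),\qquad v(0)=0,\quad v'(0)=0$$ (extended by $0$ to $t<0$) is given by $$v(t)=\int_0^t f_0(s)\,\frac{\sin\left(\tilde\omega_s(t-s)\right)}{\omega_s(0)}\,\varrho_s(t-s)\,ds\;H(t)\qquad\text{for } t<T,$$ where $\omega_s:=\omega(\cdot+s)$, $\alpha_s:=\alpha(\cdot+s)$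 and $\varrho_s:=\exp(-\tilde\alpha_s)$.
   Context: For an integrable function $g$ write $\tilde g(t):=\int_0^t g(r)\,dr$; thus $\tilde\omega_s(t-s)=\int_0^{t-s}\omega(r+s)\,dr$ and $\tilde\alpha_s(t-s)=\int_0^{t-s}\alpha(r+s)\,dr$. $H$ is the Heaviside function ($H(t)=1$ for $t\ge 0$ and $H(t)=0$ for $t<0$). Values at $t=0$ are understood as one-sided limits from the right. For imaginary-valued $\omega$, $\sin$ is the complex function. Frequency function: a differentiable function $\omega:(0,T)\to\mathbb{R}\cup \mathrm{i}\mathbb{R}$ (with $\omega(0):=\omega(0+)$) is called a frequency function for $a,b$ if for all $t\in(0,T)$ $$\int_0^t\omega^2(s)\,ds=\int_0^t\left[b(s)-\left(\frac{a(s)}{2}\right)^2+\left(\frac{\omega'}{2\omega}\right)^2(s)\right]ds-\frac{a(t)}{2}+\frac{a(0)}{2}-\frac{\omega'}{2\omega}(t)+\frac{\omega'}{2\omega}(0).$$ The paper asserts that in both cases the denominator ($v_1^2+v_2^2$ in (i), $v_2^2-v_1^2$ in (ii)) has no zeros on $[0,T)$, and accordingly regards $\omega$ as a frequency function defined on all of $[0,T)$.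
   Formalization: In case (ii) it is additionally assumed that v_2^2-v_1^2 has no zeros on (0,T); this can fail (a=0, b=1, ω_0=1, ω_1=0 gives cos 2t, zero at π/4), and then ω is undefined there. *)

theory Defs
  imports "HOL-Analysis.Analysis"
begin

text \<open>Throughout, \<open>einterval 0 T\<close> is the set of reals in \<open>(0,T)\<close>, where \<open>T\<close> may be \<open>\<infinity>\<close>.\<close>

text \<open>The function \<open>v\<close> solves \<open>v'' + a v' + b v = f\<close> on \<open>(0,T)\<close> with \<open>v(0) = y0\<close> and \<open>v'(0) = y1\<close>.
  Values at the left end point are limits from the right; in particular \<open>deriv v 0\<close>, which would be
  a two-sided derivative, is never used.\<close>

definition ivp_solution ::
    "ereal \<Rightarrow> (real \<Rightarrow> real) \<Rightarrow> (real \<Rightarrow> real) \<Rightarrow> (real \<Rightarrow> real) \<Rightarrow> real \<Rightarrow> real \<Rightarrow> (real \<Rightarrow> real) \<Rightarrow> bool"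
  where "ivp_solution T a b f y0 y1 v \<longleftrightarrow>
    (\<forall>t\<in>einterval 0 T.
        v differentiable (at t) \<and> deriv v differentiable (at t) \<and>
        deriv (deriv v) t + a t * deriv v t + b t * v t = f t) \<and>
    v 0 = y0 \<and> (v \<longlongrightarrow> y0) (at_right 0) \<and> (deriv v \<longlongrightarrow> y1) (at_right 0)"

definition half_log_deriv :: "(real \<Rightarrow> complex) \<Rightarrow> real \<Rightarrow> complex"
  where "half_log_deriv \<omega> t = vector_derivative \<omega> (at t) / (2 * \<omega> t)"

text \<open>The definition below makes explicit what writing down its integral identity presupposes:
  \<open>\<omega>\<close> has no zeros, both integrands are integrable, and \<open>\<omega>'/(2\<omega>)\<close> has a limit \<open>q0\<close> at \<open>0+\<close>.\<close>

definition frequency_function ::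
    "ereal \<Rightarrow> (real \<Rightarrow> real) \<Rightarrow> (real \<Rightarrow> real) \<Rightarrow> (real \<Rightarrow> complex) \<Rightarrow> bool"
  where "frequency_function T a b \<omega> \<longleftrightarrow>
    (\<forall>t\<in>einterval 0 T. \<omega> differentiable (at t) \<and> (Im (\<omega> t) = 0 \<or> Re (\<omega> t) = 0) \<and> \<omega> t \<noteq> 0) \<and>
    (\<omega> \<longlongrightarrow> \<omega> 0) (at_right 0) \<and>
    (\<exists>q0. (half_log_deriv \<omega> \<longlongrightarrow> q0) (at_right 0) \<and>
      (\<forall>t\<in>einterval 0 T.
        interval_lebesgue_integrable lborel 0 (ereal t) (\<lambda>s. (\<omega> s)\<^sup>2) \<and>
        interval_lebesgue_integrable lborel 0 (ereal t)
          (\<lambda>s. of_real (b s - (a s / 2)\<^sup>2) + (half_log_deriv \<omega> s)\<^sup>2) \<and>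
        (LBINT s=0..ereal t. (\<omega> s)\<^sup>2) =
          (LBINT s=0..ereal t. of_real (b s - (a s / 2)\<^sup>2) + (half_log_deriv \<omega> s)\<^sup>2)
          - of_real (a t / 2) + of_real (a 0 / 2) - half_log_deriv \<omega> t + q0))"

definition primitive :: "(real \<Rightarrow> complex) \<Rightarrow> real \<Rightarrow> complex"
  where "primitive g t = (LBINT r=0..ereal t. g r)"

definition shift :: "real \<Rightarrow> (real \<Rightarrow> complex) \<Rightarrow> real \<Rightarrow> complex"
  where "shift s g = (\<lambda>r. g (r + s))"

definition heaviside :: "real \<Rightarrow> real"
  where "heaviside t = (if t \<ge> 0 then 1 else 0)"

definition alpha :: "(real \<Rightarrow> real) \<Rightarrow> (real \<Rightarrow> complex) \<Rightarrow> real \<Rightarrow> complex"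
  where "alpha a \<omega> t = of_real (a t / 2) + half_log_deriv \<omega> t"

definition rho :: "(real \<Rightarrow> real) \<Rightarrow> (real \<Rightarrow> complex) \<Rightarrow> real \<Rightarrow> real \<Rightarrow> complex"
  where "rho a \<omega> s t = exp (- primitive (shift s (alpha a \<omega>)) t)"

end

theory Submission imports Defs
begin

text \<open>Variation of parameters represents the solution by the kernel
  \<open>(v\<^sub>1(t) v\<^sub>2(s) - v\<^sub>2(t) v\<^sub>1(s)) / W(s)\<close> with the Wronskian \<open>W = v\<^sub>1' v\<^sub>2 - v\<^sub>1 v\<^sub>2'\<close>. Both variants of
  \<open>\<omega>\<close> have the form \<open>-\<i> \<kappa> W / D\<close> with \<open>D = v\<^sub>2\<^sup>2 - \<kappa>\<^sup>2 v\<^sub>1\<^sup>2\<close>, where \<open>\<kappa>\<close> is \<open>\<i>\<close> or \<open>-1\<close>. With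
  \<open>p = D' / (2 D)\<close> one has \<open>\<alpha> = -p\<close>, and the factors \<open>v\<^sub>2 \<plusminus> \<kappa> v\<^sub>1\<close> of \<open>D\<close> have the logarithmic
  derivatives \<open>p \<plusminus> \<i> \<omega>\<close>. Writing the sine through exponentials of \<open>\<integral> (p \<plusminus> \<i> \<omega>)\<close> therefore turns the
  kernel of the theorem into the Wronskian kernel. The identity for the frequency function is the
  integrated form of \<open>p' = \<omega>\<^sup>2 - b - a p - p\<^sup>2\<close>.\<close>

section \<open>Interval integrals, shifted primitives and scalar linear equations\<close>

lemma LBINT_eq_integral:
  fixes g :: "real \<Rightarrow> 'a::euclidean_space"
  assumes "x \<le> t" "continuous_on {x..t} g"
  shows "(LBINT s=ereal x..ereal t. g s) = integral {x..t} g"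
  using interval_integral_eq_integral[OF assms(1) borel_integrable_atLeastAtMost'[OF assms(2)]] .

lemma LBINT_eq_diff:
  fixes g F :: "real \<Rightarrow> 'a::euclidean_space"
  assumes "x \<le> t" "continuous_on {x..t} F" "continuous_on {x..t} g"
    and "\<And>s. s \<in> {x<..<t} \<Longrightarrow> (F has_vector_derivative g s) (at s)"
  shows "(LBINT s=ereal x..ereal t. g s) = F t - F x"
  using fundamental_theorem_of_calculus_interior[OF assms(1,2,4)] LBINT_eq_integral[OF assms(1,3)]
  by (simp add: integral_unique)

text \<open>The end points form a null set, so agreement in the open interval suffices. This
  transfers integrability from a continuous extension to \<open>half_log_deriv \<omega>\<close>,
  whose value at 0 is a two-sided derivative and is not controlled.\<close>

lemma interval_lebesgue_integrable_cong':
  assumes "\<And>s. s \<in> einterval (min x y) (max x y) \<Longrightarrow> f s = g s"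
    and "interval_lebesgue_integrable lborel x y f"
  shows "interval_lebesgue_integrable lborel x y g"
proof -
  have "set_integrable lborel (einterval x y) f \<longleftrightarrow> set_integrable lborel (einterval x y) g" if "x \<le> y"
    by (rule set_integrable_cong) (use assms(1) that in \<open>auto simp: min_def max_def\<close>)
  moreover have "set_integrable lborel (einterval y x) f \<longleftrightarrow> set_integrable lborel (einterval y x) g" if "\<not> x \<le> y"
    by (rule set_integrable_cong) (use assms(1) that in \<open>auto simp: min_def max_def\<close>)
  ultimately show ?thesis
    using assms(2) unfolding interval_lebesgue_integrable_def by auto
qed

lemma integral_has_vector_derivative_interior:
  fixes g :: "real \<Rightarrow> 'a::banach"
  assumes "continuous_on {x..t} g" "u \<in> {x<..<t}"
  shows "((\<lambda>r. integral {x..r} g) has_vector_derivative g u) (at u)"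
proof -
  have "((\<lambda>r. integral {x..r} g) has_vector_derivative g u) (at u within {x..t})"
    using assms by (intro integral_has_vector_derivative) auto
  then show ?thesis
    using assms(2) at_within_Icc_at[of x u t] by auto
qed

lemma primitive_shift:
  assumes "s \<le> t" "continuous_on {s..t} g"
  shows "primitive (shift s g) (t - s) = integral {s..t} g"
proof -
  have "continuous_on {0..t - s} (\<lambda>r. g (r + s))"
    by (rule continuous_on_compose2[OF assms(2)]) (auto intro!: continuous_intros)
  then have "primitive (shift s g) (t - s) = integral {0..t - s} (\<lambda>r. g (r + s))"
    using LBINT_eq_integral[of 0 "t - s"] assms(1)
    unfolding primitive_def shift_def by (simp add: zero_ereal_def)
  also have "\<dots> = integral {s..t} g"
    using integral_shift[of 0 s "t - s" g] assms(2) by (simp add: o_def)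
  finally show ?thesis .
qed

lemma primitive_shift_cong:
  assumes "s \<le> t" "\<And>r. r \<in> {s<..<t} \<Longrightarrow> g r = h r"
  shows "primitive (shift s g) (t - s) = primitive (shift s h) (t - s)"
  unfolding primitive_def shift_def
  by (rule interval_integral_cong) (use assms in \<open>auto simp: zero_ereal_def min_def max_def\<close>)

text \<open>The product of \<open>z\<close> with the exponential of minus the primitive of
  \<open>q\<close> has derivative zero. No logarithm of \<open>z\<close> is taken, so
  \<open>z\<close> may be complex and is not assumed to be free of zeros. It is applied to the
  Wronskian and to the complex factors of \<open>D\<close>.\<close>

lemma linear_ode_eq_exp:
  fixes z q :: "real \<Rightarrow> 'a::{real_normed_field,banach}"
  assumes "s \<le> t" "continuous_on {s..t} z" "continuous_on {s..t} q"
    and z': "\<And>u. u \<in> {s<..<t} \<Longrightarrow> (z has_vector_derivative z u * q u) (at u)"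
  shows "z t = z s * exp (integral {s..t} q)"
proof -
  define Q where "Q u = integral {s..u} q" for u
  define k where "k u = z u * exp (- Q u)" for u
  have "continuous_on {s..t} Q"
    unfolding Q_def
    by (intro indefinite_integral_continuous_1 integrable_continuous_real assms)
  then have "continuous_on {s..t} k"
    unfolding k_def by (intro continuous_intros assms)
  moreover have "(k has_vector_derivative 0) (at u)" if u: "u \<in> {s<..<t}" for u
  proof -
    have "(Q has_vector_derivative q u) (at u)"
      unfolding Q_def by (rule integral_has_vector_derivative_interior[OF assms(3) u])
    then have "((\<lambda>u. - Q u) has_vector_derivative - q u) (at u)"
      by (rule has_vector_derivative_minus)
    from field_vector_diff_chain_at[OF this DERIV_exp]
    have "((\<lambda>u. exp (- Q u)) has_vector_derivative - q u * exp (- Q u)) (at u)"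
      by (simp add: o_def)
    from has_vector_derivative_mult[OF z'[OF u] this] show ?thesis
      unfolding k_def by (simp add: algebra_simps)
  qed
  ultimately have "((\<lambda>_. 0) has_integral (k t - k s)) {s..t}"
    using fundamental_theorem_of_calculus_interior[OF assms(1), of k "\<lambda>_. 0"] by blast
  then have "k t = k s"
    by (simp add: has_integral_0_eq)
  then show ?thesis
    by (simp add: k_def Q_def exp_minus field_simps)
qed

section \<open>First-order form of the initial value problem\<close>

text \<open>First-order form of \<open>ivp_solution\<close>: \<open>d\<close> is the derivative of \<open>v\<close> extended continuously to \<open>0\<close>.\<close>

definition linear_ode_solution ::
    "ereal \<Rightarrow> (real \<Rightarrow> real) \<Rightarrow> (real \<Rightarrow> real) \<Rightarrow> (real \<Rightarrow> real) \<Rightarrow> (real \<Rightarrow> real) \<Rightarrow> (real \<Rightarrow> real) \<Rightarrow> bool"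
  where "linear_ode_solution T a b f v d \<longleftrightarrow>
    continuous_on {t. 0 \<le> t \<and> ereal t < T} v \<and> continuous_on {t. 0 \<le> t \<and> ereal t < T} d \<and>
    (\<forall>t\<in>einterval 0 T. (v has_real_derivative d t) (at t) \<and>
      (d has_real_derivative f t - a t * d t - b t * v t) (at t))"

lemma einterval_0_iff: "t \<in> einterval 0 T \<longleftrightarrow> 0 < t \<and> ereal t < T"
  by (simp add: einterval_iff)

lemma eventually_at_right_einterval:
  assumes "0 < T"
  shows "eventually (\<lambda>t. t \<in> einterval 0 T) (at_right 0)"
proof -
  obtain c :: real where c: "0 < c" "ereal c < T"
    using einterval_nonempty[OF assms] by (auto simp: einterval_0_iff)
  show ?thesis
    unfolding eventually_at_right_field
  proof (intro exI[of _ c] conjI allI impI)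
    fix y :: real assume "0 < y" "y < c"
    then show "y \<in> einterval 0 T"
      using c by (auto simp: einterval_0_iff intro: less_trans[of "ereal y" "ereal c"])
  qed (use c in auto)
qed

lemma ereal_le_less_trans: "x \<le> y \<Longrightarrow> ereal y < T \<Longrightarrow> ereal x < T"
  by (metis ereal_less_eq(3) le_less_trans)

text \<open>Relative to the half-open domain, neighbourhoods of 0 are right neighbourhoods, and
  those of any other point are ordinary ones. This translates between continuity up to 0 and the
  one-sided limits of the definitions.\<close>

lemma continuous_on_half_open_iff:
  fixes g :: "real \<Rightarrow> 'a::topological_space"
  assumes "0 < T"
  shows "continuous_on {t. 0 \<le> t \<and> ereal t < T} g \<longleftrightarrow>
    (\<forall>t\<in>einterval 0 T. isCont g t) \<and> (g \<longlongrightarrow> g 0) (at_right 0)"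
proof -
  let ?J = "{t. 0 \<le> t \<and> ereal t < T}"
  have J: "?J = insert 0 (einterval 0 T)"
    using assms by (auto simp: einterval_0_iff simp flip: zero_ereal_def)
  have "at t within ?J = at t" if "t \<in> einterval 0 T" for t
    using that J by (intro at_within_open_subset[of t "einterval 0 T"]) auto
  moreover have "at 0 within ?J = at_right 0"
  proof -
    obtain c :: real where c: "0 < c" "ereal c < T"
      using einterval_nonempty[OF assms] by (auto simp: einterval_0_iff)
    have "at 0 within ?J = at 0 within {0<..}"
      by (rule at_within_nhd[of _ "{..<c}"])
        (use c in \<open>auto intro: ereal_le_less_trans[OF less_imp_le]\<close>)
    then show ?thesis .
  qed
  ultimately show ?thesis
    unfolding continuous_on_def by (auto simp: J isCont_def)
qed

lemma ivp_solution_iff: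
  assumes "0 < T"
  shows "ivp_solution T a b f y0 y1 v \<longleftrightarrow>
    (\<exists>d. linear_ode_solution T a b f v d \<and> v 0 = y0 \<and> d 0 = y1)"
proof
  assume v: "ivp_solution T a b f y0 y1 v"
  \<comment> \<open>The value \<open>deriv v 0\<close> carries no information about the right limit,
    so it is overwritten by that limit.\<close>
  define d where "d = (deriv v)(0 := y1)"
  have ev: "\<forall>\<^sub>F t in at_right 0. deriv v t = d t"
    by (auto simp: d_def eventually_at_filter)
  have d: "d t = deriv v t" if "t \<in> einterval 0 T" for t
    using that by (auto simp: d_def einterval_0_iff)
  have v': "(v has_real_derivative d t) (at t)"
    and d': "(d has_real_derivative f t - a t * d t - b t * v t) (at t)"
    if t: "t \<in> einterval 0 T" for t
  proof -
    show "(v has_real_derivative d t) (at t)"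
      using v t d by (auto simp: ivp_solution_def DERIV_deriv_iff_real_differentiable)
    have "deriv (deriv v) t = f t - a t * d t - b t * v t"
      using v t d unfolding ivp_solution_def by (simp add: algebra_simps)
    moreover have "(deriv v has_real_derivative deriv (deriv v) t) (at t)"
      using v t by (simp add: ivp_solution_def DERIV_deriv_iff_real_differentiable)
    ultimately have "(deriv v has_real_derivative f t - a t * d t - b t * v t) (at t)"
      by simp
    then show "(d has_real_derivative f t - a t * d t - b t * v t) (at t)"
      by (rule has_field_derivative_transform_within_open[OF _ open_einterval t])
        (simp add: d)
  qed
  have "(d \<longlongrightarrow> d 0) (at_right 0)"
    using v ev unfolding ivp_solution_def by (auto simp: d_def elim: Lim_transform_eventually)
  then have "linear_ode_solution T a b f v d"
    using v v' d' unfolding linear_ode_solution_def continuous_on_half_open_iff[OF assms] ivp_solution_def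
    by (auto intro: DERIV_isCont)
  then show "\<exists>d. linear_ode_solution T a b f v d \<and> v 0 = y0 \<and> d 0 = y1"
    using v by (auto simp: ivp_solution_def d_def)
next
  assume "\<exists>d. linear_ode_solution T a b f v d \<and> v 0 = y0 \<and> d 0 = y1"
  then obtain d where "linear_ode_solution T a b f v d" and 0: "v 0 = y0" "d 0 = y1"
    by blast
  then have v': "(v has_real_derivative d t) (at t)"
    and d': "(d has_real_derivative f t - a t * d t - b t * v t) (at t)"
    and lim: "(v \<longlongrightarrow> v 0) (at_right 0)" "(d \<longlongrightarrow> d 0) (at_right 0)"
    if "t \<in> einterval 0 T" for t
    using that unfolding linear_ode_solution_def continuous_on_half_open_iff[OF assms] by auto
  have d: "deriv v t = d t" if "t \<in> einterval 0 T" for t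
    using v'[OF that] by (rule DERIV_imp_deriv)
  have d'': "(deriv v has_real_derivative f t - a t * d t - b t * v t) (at t)"
    if "t \<in> einterval 0 T" for t
    by (rule has_field_derivative_transform_within_open[OF d'[OF that] open_einterval that])
      (simp add: d)
  obtain c where c: "c \<in> einterval 0 T"
    using einterval_nonempty[OF assms] by blast
  have "(deriv v \<longlongrightarrow> d 0) (at_right 0)"
    using eventually_at_right_einterval[OF assms]
    by (intro Lim_transform_eventually[OF lim(2)[OF c]]) (auto elim!: eventually_mono simp: d)
  then show "ivp_solution T a b f y0 y1 v"
    using v' d'' d 0 lim(1)[OF c] DERIV_imp_deriv[OF d'']
    unfolding ivp_solution_def by (auto simp: real_differentiable_def)
qed

text \<open>The products \<open>d e\<close> and the terms with \<open>b\<close> cancel, which leaves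
  Abel's equation with source \<open>f u\<close>. With \<open>f = 0\<close> it governs
  \<open>W\<close>; with a general source it drives variation of parameters.\<close>

lemma wronskian_has_derivative:
  assumes "linear_ode_solution T a b f v d" "linear_ode_solution T a b (\<lambda>_. 0) u e" "t \<in> einterval 0 T"
  shows "((\<lambda>t. d t * u t - v t * e t) has_real_derivative
    f t * u t - a t * (d t * u t - v t * e t)) (at t)"
proof -
  have [derivative_intros]: "(v has_real_derivative d t) (at t)" "(u has_real_derivative e t) (at t)"
    "(d has_real_derivative f t - a t * d t - b t * v t) (at t)"
    "(e has_real_derivative 0 - a t * e t - b t * u t) (at t)"
    using assms unfolding linear_ode_solution_def by auto
  show ?thesis
    by (rule derivative_eq_intros refl)+ (simp add: algebra_simps)
qed

section \<open>Variation of parameters for a fundamental pair\<close>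

text \<open>The initial data enter through the sign of the Wronskian at 0, whose value for the data
  of the theorem is \<open>1 / \<omega>\<^sub>0\<close>.\<close>

locale homogeneous_pair =
  fixes T :: ereal and a b v1 d1 v2 d2 :: "real \<Rightarrow> real"
  assumes T_pos: "0 < T"
    and a_cont: "continuous_on {t. 0 \<le> t \<and> ereal t < T} a"
    and b_cont: "continuous_on {t. 0 \<le> t \<and> ereal t < T} b"
    and sol1: "linear_ode_solution T a b (\<lambda>_. 0) v1 d1"
    and sol2: "linear_ode_solution T a b (\<lambda>_. 0) v2 d2"
    and wronskian_0_pos: "0 < d1 0 * v2 0 - v1 0 * d2 0"
begin

abbreviation J :: "real set"
  where "J \<equiv> {t. 0 \<le> t \<and> ereal t < T}"

definition W :: "real \<Rightarrow> real"
  where "W t = d1 t * v2 t - v1 t * d2 t"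

lemma Icc_subset: "0 \<le> s \<Longrightarrow> t \<in> J \<Longrightarrow> {s..t} \<subseteq> J"
  by (auto intro: ereal_le_less_trans)

lemma Ioo_subset: "0 \<le> s \<Longrightarrow> t \<in> J \<Longrightarrow> {s<..<t} \<subseteq> einterval 0 T"
  by (auto simp: einterval_0_iff intro: ereal_le_less_trans[OF less_imp_le])

lemma einterval_subset: "einterval 0 T \<subseteq> J"
  by (auto simp: einterval_0_iff)

lemma sol_derivs [derivative_intros]:
  assumes "t \<in> einterval 0 T"
  shows "(v1 has_real_derivative d1 t) (at t)" "(v2 has_real_derivative d2 t) (at t)"
    "(d1 has_real_derivative - a t * d1 t - b t * v1 t) (at t)"
    "(d2 has_real_derivative - a t * d2 t - b t * v2 t) (at t)"
  using sol1 sol2 assms unfolding linear_ode_solution_def by auto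

lemma sol_cont [continuous_intros]:
  "continuous_on J v1" "continuous_on J v2" "continuous_on J d1" "continuous_on J d2"
  using sol1 sol2 unfolding linear_ode_solution_def by auto

lemma W_cont: "continuous_on J W"
  unfolding W_def by (intro continuous_intros)

lemma W_deriv: "t \<in> einterval 0 T \<Longrightarrow> (W has_real_derivative - a t * W t) (at t)"
  using wronskian_has_derivative[OF sol1 sol2] unfolding W_def by simp

text \<open>Abel's formula: \<open>W\<close> is its positive initial value times a real
  exponential.\<close>

lemma W_pos:
  assumes "t \<in> J"
  shows "0 < W t"
proof -
  have "W t = W 0 * exp (integral {0..t} (\<lambda>s. - a s))"
  proof (rule linear_ode_eq_exp)
    show "continuous_on {0..t} W" "continuous_on {0..t} (\<lambda>s. - a s)"
      using continuous_on_subset[OF W_cont Icc_subset] continuous_on_subset[OF a_cont Icc_subset] assms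
      by (auto intro: continuous_intros)
    show "(W has_vector_derivative W u * - a u) (at u)" if "u \<in> {0<..<t}" for u
      using W_deriv[of u] Ioo_subset[of 0 t] assms that
      by (auto simp: mult.commute simp flip: has_real_derivative_iff_has_vector_derivative)
  qed (use assms in auto)
  then show ?thesis
    using wronskian_0_pos by (simp add: W_def)
qed

lemma W_nonzero: "t \<in> J \<Longrightarrow> W t \<noteq> 0"
  using W_pos by force

text \<open>The mixed Wronskian of \<open>v\<close> and \<open>u\<close> and the Wronskian
  \<open>W\<close> have the same damping term, so it drops out of their quotient, whose derivative
  is \<open>f u / W\<close>. The quotient vanishes at 0 by the zero initial data of
  \<open>v\<close>.\<close>

lemma integral_wronskian_quotient:
  assumes f: "continuous_on J f" and v: "linear_ode_solution T a b f v d" "v 0 = 0" "d 0 = 0"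
    and u: "linear_ode_solution T a b (\<lambda>_. 0) u e" and t: "t \<in> J"
  shows "integral {0..t} (\<lambda>s. f s * u s / W s) = (d t * u t - v t * e t) / W t"
proof -
  define F where "F s = (d s * u s - v s * e s) / W s" for s
  have "continuous_on J F"
    using v u W_nonzero unfolding F_def linear_ode_solution_def
    by (intro continuous_intros W_cont) auto
  then have cont: "continuous_on {0..t} F"
    using Icc_subset[of 0 t] t continuous_on_subset by blast
  have "(F has_vector_derivative f s * u s / W s) (at s)" if "s \<in> {0<..<t}" for s
  proof -
    have s: "s \<in> einterval 0 T" using Ioo_subset[of 0 t] t that by auto
    then have "W s \<noteq> 0" using einterval_subset W_nonzero by auto
    from DERIV_divide[OF wronskian_has_derivative[OF v(1) u s] W_deriv[OF s] this]
    have "(F has_real_derivative f s * u s / W s) (at s)"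
      unfolding F_def by (rule DERIV_cong) (use \<open>W s \<noteq> 0\<close> in \<open>simp add: field_simps\<close>)
    then show ?thesis
      by (simp add: has_real_derivative_iff_has_vector_derivative)
  qed
  then have "((\<lambda>s. f s * u s / W s) has_integral (F t - F 0)) {0..t}"
    using fundamental_theorem_of_calculus_interior[OF _ cont] t by auto
  then show ?thesis
    using v by (simp add: F_def integral_unique)
qed

text \<open>The Cauchy kernel: for \<open>s\<close> in the interior it is, as a function of
  \<open>t\<close>, the homogeneous solution with value 0 and slope 1 at
  \<open>t = s\<close>.\<close>

definition kernel :: "real \<Rightarrow> real \<Rightarrow> real"
  where "kernel t s = (v1 t * v2 s - v2 t * v1 s) / W s"

definition variation :: "(real \<Rightarrow> real) \<Rightarrow> real \<Rightarrow> real"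
  where "variation f t = integral {0..t} (\<lambda>s. f s * kernel t s)"

lemma quotient_cont:
  assumes "continuous_on J f" "continuous_on J u"
  shows "continuous_on J (\<lambda>s. f s * u s / W s)"
  using W_nonzero by (intro continuous_intros assms W_cont) auto

lemma kernel_cont:
  assumes "continuous_on J f"
  shows "continuous_on J (\<lambda>s. f s * kernel t s)"
  using W_nonzero unfolding kernel_def by (intro continuous_intros assms W_cont) auto

lemma variation_eq:
  assumes "continuous_on J f" "t \<in> J"
  shows "variation f t =
    v1 t * integral {0..t} (\<lambda>s. f s * v2 s / W s) - v2 t * integral {0..t} (\<lambda>s. f s * v1 s / W s)"
proof -
  have "(\<lambda>s. f s * u s / W s) integrable_on {0..t}" if "continuous_on J u" for u
    using continuous_on_subset[OF quotient_cont[OF assms(1) that] Icc_subset[of 0 t]] assms(2)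
    by (intro integrable_continuous_real) auto
  note int = this[OF sol_cont(1)] this[OF sol_cont(2)]
  have "variation f t =
    integral {0..t} (\<lambda>s. v1 t * (f s * v2 s / W s) - v2 t * (f s * v1 s / W s))"
    unfolding variation_def kernel_def
    by (intro arg_cong2[where f = integral] ext) (simp_all add: diff_divide_distrib algebra_simps)
  also have "\<dots> = v1 t * integral {0..t} (\<lambda>s. f s * v2 s / W s) - v2 t * integral {0..t} (\<lambda>s. f s * v1 s / W s)"
    using integral_diff[OF integrable_on_mult_right[OF int(2), of "v1 t"] integrable_on_mult_right[OF int(1), of "v2 t"]]
    by (simp only: integral_mult_right)
  finally show ?thesis .
qed

text \<open>The quotient identities for \<open>u = v1\<close> and \<open>u = v2\<close> are two
  linear equations for \<open>v t\<close> and \<open>d t\<close>; eliminating \<open>d t\<close>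
  leaves \<open>v t\<close> times \<open>W t\<close>. This gives uniqueness together with the
  formula.\<close>

lemma solution_eq_variation:
  assumes "continuous_on J f" "linear_ode_solution T a b f v d" "v 0 = 0" "d 0 = 0" "t \<in> J"
  shows "v t = variation f t"
proof -
  have "variation f t = (v1 t * (d t * v2 t - v t * d2 t) - v2 t * (d t * v1 t - v t * d1 t)) / W t"
    using integral_wronskian_quotient[OF assms(1-4) sol1 assms(5)]
      integral_wronskian_quotient[OF assms(1-4) sol2 assms(5)]
    by (simp only: variation_eq[OF assms(1,5)] times_divide_eq_right diff_divide_distrib[symmetric])
  also have "\<dots> = v t * W t / W t"
    by (simp add: W_def algebra_simps)
  finally show ?thesis
    using W_nonzero[OF assms(5)] by simp
qed

text \<open>Existence, including continuity of the solution and its derivative up to 0. The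
  derivative is obtained by differentiating only \<open>v1\<close> and \<open>v2\<close>, since the
  contributions of the two integrals cancel.\<close>

lemma variation_solution:
  assumes f: "continuous_on J f"
  shows "\<exists>d. linear_ode_solution T a b f (\<lambda>t. if t < 0 then 0 else variation f t) d \<and> d 0 = 0"
proof -
  define A where "A t = integral {0..t} (\<lambda>s. f s * v2 s / W s)" for t
  define B where "B t = integral {0..t} (\<lambda>s. f s * v1 s / W s)" for t
  define v where "v t = v1 t * A t - v2 t * B t" for t
  define d where "d t = d1 t * A t - d2 t * B t" for t
  let ?v = "\<lambda>t. if t < 0 then 0 else variation f t"
  have prim_deriv: "((\<lambda>r. integral {0..r} (\<lambda>s. f s * u s / W s)) has_real_derivative f t * u t / W t) (at t)"
    if "continuous_on J u" and t: "t \<in> einterval 0 T" for u t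
  proof -
    \<comment> \<open>With \<open>c\<close> strictly beyond \<open>t\<close>, the point
      \<open>t\<close> is interior to \<open>{0..c}\<close> and the derivative is two-sided.\<close>
    obtain c where c: "t < c" "ereal c < T"
      using t ereal_dense3[of "ereal t" T] by (auto simp: einterval_0_iff)
    have "0 < t" using t by (simp add: einterval_0_iff)
    have "continuous_on {0..c} (\<lambda>s. f s * u s / W s)"
      using continuous_on_subset[OF quotient_cont[OF f that(1)] Icc_subset[of 0 c]] c \<open>0 < t\<close> by auto
    from integral_has_vector_derivative_interior[OF this, of t] show ?thesis
      using c \<open>0 < t\<close> by (simp add: has_real_derivative_iff_has_vector_derivative)
  qed
  have prim_cont: "continuous_on J (\<lambda>r. integral {0..r} (\<lambda>s. f s * u s / W s))"
    if u: "continuous_on J u" for u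
  proof -
    obtain c where c: "c \<in> einterval 0 T"
      using einterval_nonempty[OF T_pos] by blast
    have "continuous_on {0..c} (\<lambda>s. f s * u s / W s)"
      using continuous_on_subset[OF quotient_cont[OF f u] Icc_subset[of 0 c]] c einterval_subset by auto
    then have "continuous_on {0..c} (\<lambda>r. integral {0..r} (\<lambda>s. f s * u s / W s))"
      by (intro indefinite_integral_continuous_1 integrable_continuous_real)
    then have "((\<lambda>r. integral {0..r} (\<lambda>s. f s * u s / W s)) \<longlongrightarrow> integral {0..0} (\<lambda>s. f s * u s / W s)) (at_right 0)"
      by (rule continuous_on_Icc_at_rightD) (use c in \<open>simp add: einterval_0_iff\<close>)
    then show ?thesis
      using prim_deriv[OF u] by (auto simp: continuous_on_half_open_iff[OF T_pos] intro: DERIV_isCont)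
  qed
  have cont: "continuous_on J v" "continuous_on J d"
    unfolding v_def d_def A_def B_def by (intro continuous_intros prim_cont sol_cont)+
  have eq: "v t = ?v t" if "t \<in> J" for t
    using variation_eq[OF f that] that by (simp add: v_def A_def B_def)
  have "(v has_real_derivative d t) (at t)" "(d has_real_derivative f t - a t * d t - b t * v t) (at t)"
    if t: "t \<in> einterval 0 T" for t
  proof -
    have W: "W t \<noteq> 0" using t einterval_subset W_nonzero by auto
    have [derivative_intros]: "(A has_real_derivative f t * v2 t / W t) (at t)"
      "(B has_real_derivative f t * v1 t / W t) (at t)"
      unfolding A_def B_def by (intro prim_deriv sol_cont t)+
    show "(v has_real_derivative d t) (at t)"
      unfolding v_def d_def
      by (rule derivative_eq_intros t refl)+ (simp add: algebra_simps)
    \<comment> \<open>Here the contributions of the two integrals do not cancel: they combine to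
      \<open>f t * W t / W t\<close>, which produces the source term.\<close>
    have "(d has_real_derivative (- a t * d1 t - b t * v1 t) * A t - (- a t * d2 t - b t * v2 t) * B t
        + f t * (d1 t * v2 t - v1 t * d2 t) / W t) (at t)"
      unfolding d_def
      by (rule derivative_eq_intros t refl)+ (simp add: algebra_simps diff_divide_distrib)
    then show "(d has_real_derivative f t - a t * d t - b t * v t) (at t)"
      using W unfolding W_def[symmetric] by (rule_tac DERIV_cong) (auto simp: d_def v_def algebra_simps)
  qed
  note derivs = this
  have "(?v has_real_derivative d t) (at t)" if "t \<in> einterval 0 T" for t
    by (rule has_field_derivative_transform_within_open[OF derivs(1)[OF that] open_einterval that])
      (use eq einterval_subset in blast)
  moreover have "continuous_on J ?v"
    using cont(1) eq by (simp cong: continuous_on_cong_simp)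
  moreover have "d 0 = 0"
    by (simp add: d_def A_def B_def)
  ultimately show ?thesis
    using derivs(2) cont(2) eq einterval_subset unfolding linear_ode_solution_def
    by (intro exI[of _ d]) (auto simp: subset_iff)
qed

end

section \<open>The frequency function and the sine kernel\<close>

text \<open>Case (i) of the theorem is \<open>\<kappa> = \<i>\<close>, \<open>\<sigma> = -1\<close>; case (ii) is \<open>\<kappa> = -1\<close>, \<open>\<sigma> = 1\<close>.\<close>

locale frequency_pair = homogeneous_pair +
  fixes \<kappa> :: complex and \<sigma> :: real and \<omega> :: "real \<Rightarrow> complex"
  assumes \<kappa>_nonzero: "\<kappa> \<noteq> 0"
    and \<kappa>_square: "\<kappa>\<^sup>2 = of_real \<sigma>"
    and D_pos: "t \<in> J \<Longrightarrow> 0 < (v2 t)\<^sup>2 - \<sigma> * (v1 t)\<^sup>2"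
    and \<omega>_eq: "t \<in> J \<Longrightarrow> \<omega> t = - \<i> * \<kappa> * of_real (W t / ((v2 t)\<^sup>2 - \<sigma> * (v1 t)\<^sup>2))"
begin

definition D :: "real \<Rightarrow> real"
  where "D t = (v2 t)\<^sup>2 - \<sigma> * (v1 t)\<^sup>2"

definition p :: "real \<Rightarrow> real"
  where "p t = (v2 t * d2 t - \<sigma> * v1 t * d1 t) / D t"

lemma D_nonzero: "t \<in> J \<Longrightarrow> D t \<noteq> 0"
  using D_pos unfolding D_def by force

lemma D_cont: "continuous_on J D"
  unfolding D_def by (intro continuous_intros)

lemma p_cont: "continuous_on J p"
  using D_nonzero unfolding p_def by (intro continuous_intros D_cont) auto

lemma R_cont: "continuous_on J (\<lambda>t. W t / D t)"
  using D_nonzero by (intro continuous_intros D_cont W_cont) auto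

lemma \<omega>_eq': "t \<in> J \<Longrightarrow> \<omega> t = - \<i> * \<kappa> * of_real (W t / D t)"
  unfolding D_def by (rule \<omega>_eq)

lemma \<omega>_nonzero: "t \<in> J \<Longrightarrow> \<omega> t \<noteq> 0"
  using \<kappa>_nonzero W_nonzero[of t] D_nonzero[of t] by (simp add: \<omega>_eq')

lemma \<omega>_cont: "continuous_on J \<omega>"
proof -
  have "continuous_on J (\<lambda>t. - \<i> * \<kappa> * of_real (W t / D t))"
    by (intro continuous_intros R_cont)
  then show ?thesis
    by (rule continuous_on_eq) (simp add: \<omega>_eq')
qed

lemma D_deriv:
  assumes "t \<in> einterval 0 T"
  shows "(D has_real_derivative 2 * p t * D t) (at t)"
proof -
  have "D t \<noteq> 0" using D_nonzero assms einterval_subset by auto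
  then have "2 * p t * D t = 2 * (v2 t * d2 t - \<sigma> * v1 t * d1 t)"
    by (simp add: p_def)
  moreover have "(D has_real_derivative 2 * (v2 t * d2 t - \<sigma> * v1 t * d1 t)) (at t)"
    unfolding D_def
    by (rule derivative_eq_intros assms refl)+ (simp add: algebra_simps)
  ultimately show ?thesis by simp
qed

text \<open>The logarithmic derivatives of \<open>W\<close> and \<open>D\<close> are
  \<open>- a\<close> and \<open>2 * p\<close>, and \<open>\<omega>\<close> is a constant multiple of
  \<open>W / D\<close>.\<close>

lemma \<omega>_deriv:
  assumes t: "t \<in> einterval 0 T"
  shows "(\<omega> has_vector_derivative \<omega> t * of_real (- a t - 2 * p t)) (at t)"
proof -
  have "t \<in> J" using t einterval_subset by auto
  then have D: "D t \<noteq> 0" by (rule D_nonzero)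
  have "((\<lambda>t. W t / D t) has_real_derivative (W t / D t) * (- a t - 2 * p t)) (at t)"
    by (rule DERIV_cong[OF DERIV_divide[OF W_deriv[OF t] D_deriv[OF t] D]])
      (use D in \<open>simp add: field_simps\<close>)
  then have "((\<lambda>t. - \<i> * \<kappa> * of_real (W t / D t)) has_vector_derivative
      - \<i> * \<kappa> * of_real ((W t / D t) * (- a t - 2 * p t))) (at t)"
    by (intro has_vector_derivative_mult_right has_vector_derivative_of_real)
      (simp add: has_real_derivative_iff_has_vector_derivative)
  then have "(\<omega> has_vector_derivative
      - \<i> * \<kappa> * of_real ((W t / D t) * (- a t - 2 * p t))) (at t)"
    by (rule has_vector_derivative_transform_within_open[OF _ open_einterval t])
      (use einterval_subset in \<open>auto simp: \<omega>_eq'\<close>)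
  then show ?thesis
    by (simp add: \<omega>_eq'[OF \<open>t \<in> J\<close>] mult.assoc)
qed

text \<open>The Riccati equation of \<open>p\<close>. Its first term is
  \<open>\<omega>\<^sup>2\<close>, because
  \<open>(- \<i> * \<kappa>)\<^sup>2 = - \<sigma>\<close>.\<close>

lemma p_deriv:
  assumes t: "t \<in> einterval 0 T"
  shows "(p has_real_derivative - \<sigma> * (W t / D t)\<^sup>2 - b t - a t * p t - (p t)\<^sup>2) (at t)"
proof -
  define N where "N t = v2 t * d2 t - \<sigma> * v1 t * d1 t" for t
  have D: "D t \<noteq> 0" using D_nonzero t einterval_subset by auto
  have N: "p t * D t = N t" using D by (simp add: p_def N_def)
  have "(N has_real_derivative (d2 t)\<^sup>2 - \<sigma> * (d1 t)\<^sup>2 - a t * N t - b t * D t) (at t)"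
    unfolding N_def D_def
    by (rule derivative_eq_intros t refl)+ (simp add: algebra_simps power2_eq_square)
  from DERIV_divide[OF this D_deriv[OF t] D]
  have "(p has_real_derivative
      (((d2 t)\<^sup>2 - \<sigma> * (d1 t)\<^sup>2 - a t * N t - b t * D t) * D t - N t * (2 * p t * D t)) / (D t * D t)) (at t)"
    unfolding N_def p_def .
  \<comment> \<open>Brahmagupta's identity for the form
    \<open>x\<^sup>2 - \<sigma> * y\<^sup>2\<close>; it trades the squares of the derivatives for
    the Wronskian.\<close>
  moreover have "((d2 t)\<^sup>2 - \<sigma> * (d1 t)\<^sup>2) * D t = (N t)\<^sup>2 - \<sigma> * (W t)\<^sup>2"
    unfolding D_def N_def W_def by algebra
  then have "(((d2 t)\<^sup>2 - \<sigma> * (d1 t)\<^sup>2 - a t * N t - b t * D t) * D t - N t * (2 * p t * D t)) / (D t * D t)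
      = - \<sigma> * (W t / D t)\<^sup>2 - b t - a t * p t - (p t)\<^sup>2"
    using D unfolding N[symmetric] by (simp add: field_simps power2_eq_square)
  ultimately show ?thesis by simp
qed

text \<open>The term \<open>a / 2\<close> cancels in \<open>alpha\<close>, which is therefore
  \<open>- p\<close>.\<close>

lemma half_log_deriv_\<omega>:
  assumes t: "t \<in> einterval 0 T"
  shows "half_log_deriv \<omega> t = - of_real (a t / 2 + p t)"
proof -
  have "\<omega> t \<noteq> 0"
    using \<omega>_nonzero t einterval_subset by auto
  then show ?thesis
    unfolding half_log_deriv_def vector_derivative_at[OF \<omega>_deriv[OF t]]
    by (simp add: field_simps)
qed

lemma \<omega>_square: "t \<in> J \<Longrightarrow> (\<omega> t)\<^sup>2 = of_real (- \<sigma> * (W t / D t)\<^sup>2)"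
  by (simp add: \<omega>_eq' power_mult_distrib power_divide \<kappa>_square)

text \<open>A complex number with real square lies on the real or the imaginary axis, and a factor
  \<open>- \<i>\<close> only exchanges the axes.\<close>

lemma \<omega>_axis: "t \<in> J \<Longrightarrow> Im (\<omega> t) = 0 \<or> Re (\<omega> t) = 0"
proof -
  have "Im (\<kappa>\<^sup>2) = 0" by (simp add: \<kappa>_square)
  then have "Im \<kappa> = 0 \<or> Re \<kappa> = 0" by (auto simp: power2_eq_square)
  then show "t \<in> J \<Longrightarrow> Im (\<omega> t) = 0 \<or> Re (\<omega> t) = 0" by (auto simp: \<omega>_eq')
qed

lemma frequency_function_\<omega>: "frequency_function T a b \<omega>"
proof -
  \<comment> \<open>The continuous extension of \<open>half_log_deriv \<omega>\<close> to 0; its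
    value there is the witness for \<open>q0\<close>.\<close>
  define q where "q t = - complex_of_real (a t / 2 + p t)" for t
  have q_cont: "continuous_on J q"
    unfolding q_def by (intro continuous_intros a_cont p_cont) simp
  have hq: "half_log_deriv \<omega> t = q t" if "t \<in> einterval 0 T" for t
    using half_log_deriv_\<omega>[OF that] by (simp add: q_def)
  have "(half_log_deriv \<omega> \<longlongrightarrow> q 0) (at_right 0)"
  proof (rule Lim_transform_eventually)
    show "(q \<longlongrightarrow> q 0) (at_right 0)"
      using q_cont continuous_on_half_open_iff[OF T_pos] by auto
    show "\<forall>\<^sub>F t in at_right 0. q t = half_log_deriv \<omega> t"
      using eventually_at_right_einterval[OF T_pos] by (rule eventually_mono) (simp add: hq)
  qed
  moreover have "(\<omega> \<longlongrightarrow> \<omega> 0) (at_right 0)"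
    using \<omega>_cont continuous_on_half_open_iff[OF T_pos] by auto
  moreover have "\<omega> differentiable (at t) \<and> (Im (\<omega> t) = 0 \<or> Re (\<omega> t) = 0) \<and> \<omega> t \<noteq> 0"
    if "t \<in> einterval 0 T" for t
  proof -
    have J: "t \<in> J" using that einterval_subset by auto
    then show ?thesis
      using \<omega>_deriv[OF that] \<omega>_axis[OF J] \<omega>_nonzero[OF J] differentiableI_vector by blast
  qed
  moreover have
    "interval_lebesgue_integrable lborel 0 (ereal t) (\<lambda>s. (\<omega> s)\<^sup>2) \<and>
     interval_lebesgue_integrable lborel 0 (ereal t)
       (\<lambda>s. of_real (b s - (a s / 2)\<^sup>2) + (half_log_deriv \<omega> s)\<^sup>2) \<and>
     (LBINT s=0..ereal t. (\<omega> s)\<^sup>2) =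
       (LBINT s=0..ereal t. of_real (b s - (a s / 2)\<^sup>2) + (half_log_deriv \<omega> s)\<^sup>2)
       - of_real (a t / 2) + of_real (a 0 / 2) - half_log_deriv \<omega> t + q 0"
    if t: "t \<in> einterval 0 T" for t
  proof -
    define h where "h s = of_real (b s - (a s / 2)\<^sup>2) + (q s)\<^sup>2" for s
    have t0: "0 < t" "t \<in> J" using t einterval_subset by (auto simp: einterval_0_iff)
    have sub: "continuous_on J g \<Longrightarrow> continuous_on {0..t} g" for g :: "real \<Rightarrow> complex"
      using continuous_on_subset[OF _ Icc_subset[of 0 t]] t0 by auto
    have h: "continuous_on {0..t} h"
      unfolding h_def by (rule sub) (intro continuous_intros a_cont b_cont q_cont, auto)
    have \<omega>2: "continuous_on {0..t} (\<lambda>s. (\<omega> s)\<^sup>2)"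
      by (rule sub) (intro continuous_intros \<omega>_cont)
    have int: "interval_lebesgue_integrable lborel 0 (ereal t) (\<lambda>s. (\<omega> s)\<^sup>2)"
      "interval_lebesgue_integrable lborel 0 (ereal t) h"
      using interval_integrable_continuous_on[of 0 t] h \<omega>2 t0 by (simp_all add: zero_ereal_def)
    have eq: "h s = of_real (b s - (a s / 2)\<^sup>2) + (half_log_deriv \<omega> s)\<^sup>2"
      if "s \<in> einterval (min 0 (ereal t)) (max 0 (ereal t))" for s
      using that t0 Ioo_subset[of 0 t] by (simp add: h_def hq zero_ereal_def min_def max_def subset_iff)
    \<comment> \<open>Completing the square gives \<open>h = b + a p + p\<^sup>2\<close>, so by the
      Riccati equation the integrand is the derivative of \<open>p\<close>.\<close>
    have "(LBINT s=ereal 0..ereal t. (\<omega> s)\<^sup>2 - h s) = of_real (p t) - of_real (p 0)"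
    proof (rule LBINT_eq_diff)
      show "continuous_on {0..t} (\<lambda>s. complex_of_real (p s))"
        by (rule sub) (intro continuous_intros p_cont)
      show "continuous_on {0..t} (\<lambda>s. (\<omega> s)\<^sup>2 - h s)"
        by (intro continuous_intros h \<omega>2)
      fix s assume "s \<in> {0<..<t}"
      then have s: "s \<in> einterval 0 T" using Ioo_subset[of 0 t] t0 by auto
      then have "s \<in> J" using einterval_subset by auto
      have "(\<omega> s)\<^sup>2 - h s = of_real (- \<sigma> * (W s / D s)\<^sup>2 - b s - a s * p s - (p s)\<^sup>2)"
        unfolding \<omega>_square[OF \<open>s \<in> J\<close>] h_def q_def
        by (simp add: power2_eq_square field_simps)
      then show "((\<lambda>s. complex_of_real (p s)) has_vector_derivative (\<omega> s)\<^sup>2 - h s) (at s)"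
        using has_vector_derivative_of_real[OF p_deriv[OF s]]
        by (simp only:)
    qed (use t0 in auto)
    moreover have "(LBINT s=0..ereal t. (\<omega> s)\<^sup>2 - h s) =
        (LBINT s=0..ereal t. (\<omega> s)\<^sup>2) - (LBINT s=0..ereal t. h s)"
      by (rule interval_lebesgue_integral_diff(2)[OF int])
    moreover have "(LBINT s=0..ereal t. h s) =
        (LBINT s=0..ereal t. of_real (b s - (a s / 2)\<^sup>2) + (half_log_deriv \<omega> s)\<^sup>2)"
      by (rule interval_integral_cong) (rule eq)
    ultimately have "(LBINT s=0..ereal t. (\<omega> s)\<^sup>2) -
       (LBINT s=0..ereal t. of_real (b s - (a s / 2)\<^sup>2) + (half_log_deriv \<omega> s)\<^sup>2) = of_real (p t) - of_real (p 0)"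
      by (simp only: zero_ereal_def)
    then have "(LBINT s=0..ereal t. (\<omega> s)\<^sup>2) =
       (LBINT s=0..ereal t. of_real (b s - (a s / 2)\<^sup>2) + (half_log_deriv \<omega> s)\<^sup>2)
       - of_real (a t / 2) + of_real (a 0 / 2) - half_log_deriv \<omega> t + q 0"
      by (simp add: hq[OF t] q_def algebra_simps)
    then show ?thesis
      using int(1) interval_lebesgue_integrable_cong'[OF eq int(2)] by blast
  qed
  ultimately show ?thesis
    unfolding frequency_function_def by blast
qed

text \<open>\<open>D\<close> factors as \<open>(v2 + \<kappa> v1) (v2 - \<kappa> v1)\<close>, and \<open>p + c W / D\<close> is the logarithmic derivative
  of the factor \<open>v2 + c v1\<close>, where \<open>c = \<plusminus>\<kappa>\<close>.\<close>

lemma factor_eq_exp: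
  fixes c :: complex
  assumes c: "c\<^sup>2 = of_real \<sigma>" and st: "0 < s" "s \<le> t" "t \<in> J"
  shows "of_real (v2 t) + c * of_real (v1 t) =
    (of_real (v2 s) + c * of_real (v1 s)) *
      exp (integral {s..t} (\<lambda>u. of_real (p u)) + c * integral {s..t} (\<lambda>u. of_real (W u / D u)))"
proof -
  let ?z = "\<lambda>u. of_real (v2 u) + c * of_real (v1 u)"
  let ?q = "\<lambda>u. complex_of_real (p u) + c * of_real (W u / D u)"
  have sub: "continuous_on J g \<Longrightarrow> continuous_on {s..t} g" for g :: "real \<Rightarrow> complex"
    using continuous_on_subset[OF _ Icc_subset[of s t]] st by auto
  have "?z t = ?z s * exp (integral {s..t} ?q)"
  proof (rule linear_ode_eq_exp)
    show "continuous_on {s..t} ?z"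
      by (rule sub) (intro continuous_intros)
    show "continuous_on {s..t} ?q"
      by (rule sub) (intro continuous_intros p_cont R_cont)
    fix u assume "u \<in> {s<..<t}"
    then have u: "u \<in> einterval 0 T" using Ioo_subset[of s t] st by auto
    then have D: "D u \<noteq> 0" using einterval_subset D_nonzero by auto
    have "(?z has_vector_derivative of_real (d2 u) + c * of_real (d1 u)) (at u)"
      using sol_derivs(1,2)[OF u]
      by (intro has_vector_derivative_add has_vector_derivative_mult_right has_vector_derivative_of_real)
        (simp_all add: has_real_derivative_iff_has_vector_derivative)
    moreover have "of_real (d2 u) + c * of_real (d1 u) = ?z u * ?q u"
    proof -
      \<comment> \<open>To avoid dividing by \<open>?z u\<close>, the claim is multiplied by
        \<open>D u\<close>, which splits into \<open>?z u\<close> and its conjugate factor;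
        \<open>D u\<close> is cancelled at the end.\<close>
      have D': "complex_of_real (D u) = ?z u * (of_real (v2 u) - c * of_real (v1 u))"
        using c by (simp add: D_def algebra_simps power2_eq_square)
      have "?q u * of_real (D u) =
          of_real (v2 u * d2 u - \<sigma> * v1 u * d1 u) + c * of_real (W u)"
        using D by (simp add: p_def field_simps)
      also have "\<dots> = (of_real (v2 u) - c * of_real (v1 u)) * (of_real (d2 u) + c * of_real (d1 u))"
        unfolding W_def by (simp add: c[symmetric] algebra_simps power2_eq_square)
      finally have "?z u * ?q u * of_real (D u) = (of_real (d2 u) + c * of_real (d1 u)) * of_real (D u)"
        unfolding D' by (simp only: mult_ac)
      then show ?thesis using D by (metis mult_right_cancel of_real_eq_0_iff)
    qed
    ultimately show "(?z has_vector_derivative ?z u * ?q u) (at u)"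
      by (simp only:)
  qed (use st in auto)
  moreover have "integral {s..t} ?q =
      integral {s..t} (\<lambda>u. of_real (p u)) + c * integral {s..t} (\<lambda>u. of_real (W u / D u))"
  proof -
    have "(\<lambda>u. complex_of_real (p u)) integrable_on {s..t}" "(\<lambda>u. complex_of_real (W u / D u)) integrable_on {s..t}"
      by (intro integrable_continuous_real sub continuous_intros p_cont R_cont)+
    then show ?thesis
      using integral_add[OF _ integrable_on_mult_right[of _ "{s..t}" c]] by (simp only: integral_mult_right)
  qed
  ultimately show ?thesis by (simp only:)
qed

lemma kernel_eq:
  assumes st: "0 < s" "s \<le> t" "t \<in> J"
  shows "sin (primitive (shift s \<omega>) (t - s)) / shift s \<omega> 0 * rho a \<omega> s (t - s) = of_real (kernel t s)"
proof -
  have sJ: "s \<in> J" using st by (auto intro: ereal_le_less_trans)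
  have sub: "continuous_on J g \<Longrightarrow> continuous_on {s..t} g" for g :: "real \<Rightarrow> complex"
    using continuous_on_subset[OF _ Icc_subset[of s t]] st by auto
  define P where "P = integral {s..t} (\<lambda>u. complex_of_real (p u))"
  define Q where "Q = integral {s..t} (\<lambda>u. complex_of_real (W u / D u))"
  have "primitive (shift s \<omega>) (t - s) = integral {s..t} \<omega>"
    using st by (intro primitive_shift sub \<omega>_cont)
  also have "\<dots> = integral {s..t} (\<lambda>u. - \<i> * \<kappa> * of_real (W u / D u))"
    using Icc_subset[of s t] st by (intro integral_cong \<omega>_eq') auto
  also have "\<dots> = - \<i> * \<kappa> * Q"
    unfolding Q_def by (simp only: integral_mult_right)
  finally have sin_arg: "primitive (shift s \<omega>) (t - s) = - \<i> * \<kappa> * Q" .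
  have "primitive (shift s (alpha a \<omega>)) (t - s) = primitive (shift s (\<lambda>u. - of_real (p u))) (t - s)"
    using Ioo_subset[of s t] st
    by (intro primitive_shift_cong) (auto simp: alpha_def half_log_deriv_\<omega> subset_iff)
  also have "\<dots> = integral {s..t} (\<lambda>u. - of_real (p u))"
    using st by (intro primitive_shift sub continuous_intros p_cont)
  finally have rho: "rho a \<omega> s (t - s) = exp P"
    by (simp add: rho_def P_def)
  let ?z = "\<lambda>c u. complex_of_real (v2 u) + c * of_real (v1 u)"
  have D: "complex_of_real (D s) = ?z \<kappa> s * ?z (- \<kappa>) s"
    using \<kappa>_square by (simp add: D_def algebra_simps power2_eq_square)
  then have nz: "?z \<kappa> s \<noteq> 0" "?z (- \<kappa>) s \<noteq> 0"
    using D_nonzero[OF sJ] by (metis mult_eq_0_iff of_real_eq_0_iff)+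
  have "exp P * exp (c * Q) * ?z c s = ?z c t" if "c\<^sup>2 = of_real \<sigma>" for c :: complex
    using factor_eq_exp[OF that st] by (simp add: P_def Q_def exp_add mult_ac)
  from this[of \<kappa>] this[of "- \<kappa>"]
  have factors: "exp P * exp (\<kappa> * Q) * ?z \<kappa> s = ?z \<kappa> t"
    "exp P * exp (- (\<kappa> * Q)) * ?z (- \<kappa>) s = ?z (- \<kappa>) t"
    using \<kappa>_square by simp_all
  \<comment> \<open>Splitting \<open>D s\<close> pairs each exponential with the factor that it
    carries from \<open>s\<close> to \<open>t\<close>. The resulting difference is odd in
    \<open>\<kappa>\<close>, so only the terms linear in \<open>\<kappa>\<close> survive, and they
    form the numerator of \<open>kernel\<close>.\<close>
  have "exp P * (exp (\<kappa> * Q) - exp (- (\<kappa> * Q))) * of_real (D s) =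
      (exp P * exp (\<kappa> * Q) * ?z \<kappa> s) * ?z (- \<kappa>) s -
      (exp P * exp (- (\<kappa> * Q)) * ?z (- \<kappa>) s) * ?z \<kappa> s"
    unfolding D by (simp only: left_diff_distrib right_diff_distrib mult_ac)
  also have "\<dots> = ?z \<kappa> t * ?z (- \<kappa>) s - ?z (- \<kappa>) t * ?z \<kappa> s"
    by (simp only: factors)
  also have "\<dots> = 2 * \<kappa> * of_real (v1 t * v2 s - v2 t * v1 s)"
    by (simp add: algebra_simps)
  finally have key: "exp P * (exp (\<kappa> * Q) - exp (- (\<kappa> * Q))) * of_real (D s) =
      2 * \<kappa> * of_real (v1 t * v2 s - v2 t * v1 s)" .
  have sin_eq: "sin (- \<i> * \<kappa> * Q) = (exp (\<kappa> * Q) - exp (- (\<kappa> * Q))) / (2 * \<i>)"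
    by (simp add: sin_exp_eq mult.assoc)
  have shift_0: "shift s \<omega> 0 = - \<i> * \<kappa> * of_real (W s / D s)"
    using \<omega>_eq'[OF sJ] by (simp add: shift_def)
  have "sin (primitive (shift s \<omega>) (t - s)) / shift s \<omega> 0 * rho a \<omega> s (t - s) =
     exp P * (exp (\<kappa> * Q) - exp (- (\<kappa> * Q))) * of_real (D s) / (2 * \<kappa> * of_real (W s))"
    unfolding sin_arg rho shift_0 sin_eq using W_nonzero[OF sJ] D_nonzero[OF sJ] \<kappa>_nonzero
    by (simp add: field_simps)
  also have "\<dots> = of_real (kernel t s)"
    unfolding key kernel_def using \<kappa>_nonzero by simp
  finally show ?thesis .
qed

end

section \<open>From the hypotheses of the theorem to the common setting\<close>

text \<open>By the intermediate value theorem, a sign change would force a zero. In the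
  imaginary-valued case this turns the nonvanishing of the denominator into positivity.\<close>

lemma pos_of_nonzero_half_open:
  fixes g :: "real \<Rightarrow> real"
  assumes "continuous_on {t. 0 \<le> t \<and> ereal t < T} g" "0 < g 0"
    and "\<And>t. t \<in> einterval 0 T \<Longrightarrow> g t \<noteq> 0" and t: "0 \<le> t" "ereal t < T"
  shows "0 < g t"
proof (rule ccontr)
  assume "\<not> 0 < g t"
  moreover have "continuous_on {0..t} g"
    using t by (intro continuous_on_subset[OF assms(1)]) (auto intro: ereal_le_less_trans)
  ultimately obtain x where x: "0 \<le> x" "x \<le> t" "g x = 0"
    using IVT2'[of g t 0 0] assms(2) t by force
  then have "0 < x"
    using assms(2) by (cases "x = 0") auto
  then have "x \<in> einterval 0 T"
    using x t by (auto simp: einterval_0_iff intro: ereal_le_less_trans)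
  then show False
    using assms(3) x by blast
qed

theorem theorem2:
  fixes T :: ereal
    and a b v\<^sub>1 v\<^sub>2 f\<^sub>0 :: "real \<Rightarrow> real"
    and \<omega>\<^sub>0 \<omega>\<^sub>1 :: real
    and \<omega> :: "real \<Rightarrow> complex"
  assumes "0 < T"
    and "continuous_on {t. 0 \<le> t \<and> ereal t < T} a"
    and "continuous_on {t. 0 \<le> t \<and> ereal t < T} b"
    and "0 < \<omega>\<^sub>0"
    and "ivp_solution T a b (\<lambda>t. 0) 0 1 v\<^sub>1"
    and "ivp_solution T a b (\<lambda>t. 0) (1 / \<omega>\<^sub>0) (- (1 / \<omega>\<^sub>0) * (a 0 / 2 + \<omega>\<^sub>1 / (2 * \<omega>\<^sub>0))) v\<^sub>2"
    and "((v\<^sub>1 0)\<^sup>2 + (v\<^sub>2 0)\<^sup>2 > 0 \<and>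
          (\<forall>t\<in>einterval 0 T. \<omega> t =
             of_real ((deriv v\<^sub>1 t * v\<^sub>2 t - v\<^sub>1 t * deriv v\<^sub>2 t) / ((v\<^sub>1 t)\<^sup>2 + (v\<^sub>2 t)\<^sup>2)))) \<or>
         ((v\<^sub>2 0)\<^sup>2 - (v\<^sub>1 0)\<^sup>2 > 0 \<and>
          (\<forall>t\<in>einterval 0 T. (v\<^sub>2 t)\<^sup>2 - (v\<^sub>1 t)\<^sup>2 \<noteq> 0) \<and>
          (\<forall>t\<in>einterval 0 T. \<omega> t =
             \<i> * of_real ((deriv v\<^sub>1 t * v\<^sub>2 t - v\<^sub>1 t * deriv v\<^sub>2 t) / ((v\<^sub>2 t)\<^sup>2 - (v\<^sub>1 t)\<^sup>2))))"
    and "(\<omega> \<longlongrightarrow> \<omega> 0) (at_right 0)"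
    and "continuous_on UNIV f\<^sub>0"
    and "closure {t. f\<^sub>0 t \<noteq> 0} \<subseteq> {0<..}"
  shows "frequency_function T a b \<omega> \<and>
    (\<exists>v. ivp_solution T a b f\<^sub>0 0 0 v \<and> (\<forall>t<0. v t = 0)) \<and>
    (\<forall>v. ivp_solution T a b f\<^sub>0 0 0 v \<and> (\<forall>t<0. v t = 0) \<longrightarrow>
      (\<forall>t. ereal t < T \<longrightarrow>
        complex_of_real (v t) =
          (LBINT s=0..ereal t. of_real (f\<^sub>0 s) *
             (sin (primitive (shift s \<omega>) (t - s)) / shift s \<omega> 0) * rho a \<omega> s (t - s))
          * of_real (heaviside t)))"
proof -
  let ?J = "{t. 0 \<le> t \<and> ereal t < T}"
  obtain d1 where s1: "linear_ode_solution T a b (\<lambda>_. 0) v\<^sub>1 d1" "v\<^sub>1 0 = 0" "d1 0 = 1"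
    using assms(5) unfolding ivp_solution_iff[OF assms(1)] by blast
  obtain d2 where s2: "linear_ode_solution T a b (\<lambda>_. 0) v\<^sub>2 d2" "v\<^sub>2 0 = 1 / \<omega>\<^sub>0"
    using assms(6) unfolding ivp_solution_iff[OF assms(1)] by blast
  interpret homogeneous_pair T a b v\<^sub>1 d1 v\<^sub>2 d2
    using assms(1-4) s1 s2 by unfold_locales auto
  have deriv: "deriv v\<^sub>1 t * v\<^sub>2 t - v\<^sub>1 t * deriv v\<^sub>2 t = W t" if "t \<in> einterval 0 T" for t
    using sol_derivs(1,2)[OF that] by (simp add: W_def DERIV_imp_deriv)
  have "\<exists>\<kappa> \<sigma>. \<kappa> \<noteq> 0 \<and> \<kappa>\<^sup>2 = complex_of_real \<sigma> \<and>
    (\<forall>t\<in>?J. 0 < (v\<^sub>2 t)\<^sup>2 - \<sigma> * (v\<^sub>1 t)\<^sup>2) \<and>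
    (\<forall>t\<in>einterval 0 T. \<omega> t = - \<i> * \<kappa> * of_real (W t / ((v\<^sub>2 t)\<^sup>2 - \<sigma> * (v\<^sub>1 t)\<^sup>2)))"
    using assms(7)
  proof (elim disjE conjE)
    assume \<omega>: "\<forall>t\<in>einterval 0 T. \<omega> t =
      of_real ((deriv v\<^sub>1 t * v\<^sub>2 t - v\<^sub>1 t * deriv v\<^sub>2 t) / ((v\<^sub>1 t)\<^sup>2 + (v\<^sub>2 t)\<^sup>2))"
    \<comment> \<open>If the sum of squares vanished, both solutions would vanish at
      \<open>t\<close>, and so would \<open>W t\<close>.\<close>
    have "0 < (v\<^sub>2 t)\<^sup>2 - (- 1) * (v\<^sub>1 t)\<^sup>2" if "t \<in> ?J" for t
      using W_nonzero[OF that] by (auto simp: W_def sum_power2_gt_zero_iff)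
    then show ?thesis
      using \<omega> deriv by (intro exI[of _ \<i>] exI[of _ "- 1"]) (auto simp: add.commute)
  next
    assume nz: "\<forall>t\<in>einterval 0 T. (v\<^sub>2 t)\<^sup>2 - (v\<^sub>1 t)\<^sup>2 \<noteq> 0" and pos: "0 < (v\<^sub>2 0)\<^sup>2 - (v\<^sub>1 0)\<^sup>2"
      and \<omega>: "\<forall>t\<in>einterval 0 T. \<omega> t =
        \<i> * of_real ((deriv v\<^sub>1 t * v\<^sub>2 t - v\<^sub>1 t * deriv v\<^sub>2 t) / ((v\<^sub>2 t)\<^sup>2 - (v\<^sub>1 t)\<^sup>2))"
    have "continuous_on ?J (\<lambda>t. (v\<^sub>2 t)\<^sup>2 - (v\<^sub>1 t)\<^sup>2)"
      by (intro continuous_intros)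
    then have "0 < (v\<^sub>2 t)\<^sup>2 - 1 * (v\<^sub>1 t)\<^sup>2" if "t \<in> ?J" for t
      using pos_of_nonzero_half_open[of T "\<lambda>t. (v\<^sub>2 t)\<^sup>2 - (v\<^sub>1 t)\<^sup>2" t] pos nz that by auto
    then show ?thesis
      using \<omega> deriv by (intro exI[of _ "- 1"] exI[of _ 1]) auto
  qed
  then obtain \<kappa> :: complex and \<sigma> where \<kappa>: "\<kappa> \<noteq> 0" "\<kappa>\<^sup>2 = of_real \<sigma>"
    and pos: "\<And>t. t \<in> ?J \<Longrightarrow> 0 < (v\<^sub>2 t)\<^sup>2 - \<sigma> * (v\<^sub>1 t)\<^sup>2"
    and \<omega>: "\<And>t. t \<in> einterval 0 T \<Longrightarrow> \<omega> t = - \<i> * \<kappa> * of_real (W t / ((v\<^sub>2 t)\<^sup>2 - \<sigma> * (v\<^sub>1 t)\<^sup>2))"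
    by blast
  let ?\<omega> = "\<lambda>t. - \<i> * \<kappa> * of_real (W t / ((v\<^sub>2 t)\<^sup>2 - \<sigma> * (v\<^sub>1 t)\<^sup>2))"
  \<comment> \<open>The formula for \<open>\<omega>\<close> is given on the open interval only; at 0
    it follows from uniqueness of the right limit.\<close>
  have "\<omega> 0 = ?\<omega> 0"
  proof (rule tendsto_unique[OF _ assms(8)])
    have "continuous_on ?J ?\<omega>"
      using pos by (intro continuous_intros W_cont) force
    then have "(?\<omega> \<longlongrightarrow> ?\<omega> 0) (at_right 0)"
      using continuous_on_half_open_iff[OF assms(1)] by blast
    then show "(\<omega> \<longlongrightarrow> ?\<omega> 0) (at_right 0)"
      by (rule Lim_transform_eventually)
        (use eventually_at_right_einterval[OF assms(1)] \<omega> in \<open>auto elim!: eventually_mono\<close>)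
  qed simp
  then have \<omega>J: "\<omega> t = ?\<omega> t" if "t \<in> ?J" for t
    using \<omega>[of t] that by (cases "t = 0") (auto simp: einterval_0_iff)
  interpret frequency_pair T a b v\<^sub>1 d1 v\<^sub>2 d2 \<kappa> \<sigma> \<omega>
    using \<kappa> pos \<omega>J by unfold_locales auto
  have f: "continuous_on ?J f\<^sub>0"
    using assms(9) continuous_on_subset by blast
  have "\<exists>v. ivp_solution T a b f\<^sub>0 0 0 v \<and> (\<forall>t<0. v t = 0)"
    using variation_solution[OF f] unfolding ivp_solution_iff[OF assms(1)]
    by (intro exI[of _ "\<lambda>t. if t < 0 then 0 else variation f\<^sub>0 t"]) (auto simp: variation_def)
  moreover have "complex_of_real (v t) =
          (LBINT s=0..ereal t. of_real (f\<^sub>0 s) *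
             (sin (primitive (shift s \<omega>) (t - s)) / shift s \<omega> 0) * rho a \<omega> s (t - s))
          * of_real (heaviside t)"
    if v: "ivp_solution T a b f\<^sub>0 0 0 v" "\<forall>t<0. v t = 0" and t: "ereal t < T" for v t
  proof (cases "t < 0")
    case True
    then show ?thesis using v by (simp add: heaviside_def)
  next
    case False
    then have J: "t \<in> ?J" using t by simp
    obtain d where "linear_ode_solution T a b f\<^sub>0 v d" "v 0 = 0" "d 0 = 0"
      using v(1) unfolding ivp_solution_iff[OF assms(1)] by blast
    then have "v t = variation f\<^sub>0 t"
      using solution_eq_variation[OF f] J by blast
    also have "\<dots> = (LBINT s=ereal 0..ereal t. f\<^sub>0 s * kernel t s)"
      unfolding variation_def
      using LBINT_eq_integral[OF _ continuous_on_subset[OF kernel_cont[OF f] Icc_subset[OF _ J]], of 0] J by simp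
    finally have "complex_of_real (v t) = (LBINT s=ereal 0..ereal t. complex_of_real (f\<^sub>0 s * kernel t s))"
      by (simp only: interval_lebesgue_integral_of_real)
    \<comment> \<open>The integrands are compared for \<open>0 < s < t\<close> only, which is where
      \<open>kernel_eq\<close> is applied.\<close>
    also have "\<dots> = (LBINT s=ereal 0..ereal t. of_real (f\<^sub>0 s) *
             (sin (primitive (shift s \<omega>) (t - s)) / shift s \<omega> 0) * rho a \<omega> s (t - s))"
      using J False
      by (intro interval_integral_cong)
        (simp add: min_def max_def mult.assoc kernel_eq del: times_divide_eq_left times_divide_eq_right)
    finally show ?thesis
      using False by (simp add: heaviside_def zero_ereal_def)
  qed
  ultimately show ?thesis
    using frequency_function_\<omega> by blast
qed

end
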